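(* Let the circulation be nonzero ($\lambda\ne0$) and $(\chi,\zeta)\neq(0,0)$, and let the system move on the level set of integrals $p_x=-\chi$, $p_y=-\zeta$, $K=0$. A complete stabilization of the body during an infinite interval of time (as defined in the context) at the position $(x,y)$ of $O_1$ with orientation $\alpha$ is possible if and only if, for some $\theta\in[0,2\pi)$, $$x=\frac{\zeta}{\lambda}+\frac{\sqrt{\chi^2+\zeta^2}}{\lambda}\cos\theta,\qquad y=-\frac{\chi}{\lambda}+\frac{\sqrt{\chi^2+\zeta^2}}{\lambda}\sin\theta,$$ and the orientation is given (modulo $2\pi$) by $$\alpha=\theta-\beta-\frac{\pi}{2},$$ where $\beta=\arctan\frac{\zeta}{\chi}$ denotes the polar angle of the vector $(\chi,\zeta)$, i.e. $\cos\beta=\chi/\sqrt{\chi^2+\zeta^2}$, $\sin\beta=\zeta/\sqrt{\chi^2+\zeta^2}$. The corresponding controls are equal to zero, i.e. the moving mass and the rotor are at rest: $\dot\xi=\dot\eta=0$, $\Omega=0$.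
   Context: Model: a two-dimensional hydrodynamically asymmetric rigid body (mass $M$, central moment of inertia $I$) moves in an unbounded ideal incompressible fluid with constant nonzero circulation $\Gamma$ around the body. It carries a point mass $m$ at $(\xi(t),\eta(t))$ in the body frame, confined to the (bounded) body, and a homogeneous circular rotor of mass $m_r$ and central moment of inertia $I_r$, rotating relative to the body with angular velocity $\Omega(t)$; $\xi(t),\eta(t),\Omega(t)$ are the controls. The body frame has its origin $O_1$ at the center of mass of the body--rotor system; $(\xi_b,\eta_b)$, $(\xi_r,\eta_r)$ are the body-frame centers of mass of body and rotor, $M\xi_b+m_r\xi_r=0$, $M\eta_b+m_r\eta_r=0$. $\lambda_1\neq\lambda_2$ are the added masses, $\lambda_6$ the added moment of inertia; $\lambda=\rho_f\Gamma$, $\zeta=\rho_f\Gamma\mu$, $\chi=\rho_f\Gamma\nu$, where $\rho_f>0$ is the fluid density and $\mu,\nu$ are constants of hydrodynamical asymmetry. $(x,y)$ are the coordinates of $O_1$ in the fixed frame, $\alpha$ the rotation angle of the body, $(v_1,v_2)$ the velocity of $O_1$ in body axes, $\omega=\dot\alpha$, with $$\dot x=v_1\cos\alpha-v_2\sin\alpha,\quad \dot y=v_1\sin\alpha+v_2\cos\alpha .$$ Put $a_i=M+m+m_r+\lambda_i$ $(i=1,2)$, $f=-m\eta$, $g=m\xi$, $b=M(\xi_b^2+\eta_b^2)+I+m(\xi^2+\eta^2)+m_r(\xi_r^2+\eta_r^2)+I_r+\lambda_6$. The motion preserves $$p_x=(a_1v_1+f\omega+m\dot\xi-\chi)\cos\alpha-(a_2v_2+g\omega+m\dot\eta-\zeta)\sin\alpha+\lambda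 y,$$ $$p_y=(a_1v_1+f\omega+m\dot\xi-\chi)\sin\alpha+(a_2v_2+g\omega+m\dot\eta-\zeta)\cos\alpha-\lambda x,$$ $$K=fv_1+gv_2+b\omega+m(\xi\dot\eta-\dot\xi\eta)+I_r\Omega+\tfrac{\lambda}{2}(x^2+y^2)+xp_y-yp_x,$$ and, on a fixed level of these integrals, they determine $(v_1,v_2,\omega)$ and hence the evolution of $(x,y,\alpha)$ for given controls. The system starts from $x=y=\alpha=0$ with the body, the rotor and the mass at rest, so the motion is on the level set $p_x=-\chi$, $p_y=-\zeta$, $K=0$. Suppose that at time $T$ the body has arrived at the point $(x,y)$ with orientation $\alpha$. A complete stabilization during an infinite interval of time is possible there if one can choose limited (bounded) controls for $t\ge T$ (the mass stays within the bounded body and its velocity and $\Omega$ are bounded) such that the body stays at $(x,y)$ with constant orientation, i.e. $\dot x=\dot y=\dot\alpha=0$, for all $t\ge T$. *)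

theory Defs
  imports "HOL-Analysis.Analysis"
begin

(* Subscripts: b = body, p = point mass, r = rotor.  "region" is the set of points, in the
   body frame, that the body occupies. *)
record params =
  m_b :: real
  I_b :: real
  xi_b :: real
  eta_b :: real
  m_p :: real
  m_r :: real
  I_r :: real
  xi_r :: real
  eta_r :: real
  lam1 :: real
  lam2 :: real
  lam6 :: real
  rho_f :: real
  circ :: real
  asym_mu :: real
  asym_nu :: real
  region :: "(real \<times> real) set"

(* The origin of the body frame is the centre of mass of the body-rotor system. *)
definition valid_params :: "params \<Rightarrow> bool" where
  "valid_params S \<longleftrightarrow>
     m_b S > 0 \<and> I_b S > 0 \<and> m_p S > 0 \<and> m_r S > 0 \<and> I_r S > 0 \<and>
     m_b S * xi_b S + m_r S * xi_r S = 0 \<and>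
     m_b S * eta_b S + m_r S * eta_r S = 0 \<and>
     lam1 S \<noteq> lam2 S \<and> rho_f S > 0 \<and> bounded (region S)"

definition lam :: "params \<Rightarrow> real" where
  "lam S = rho_f S * circ S"

definition zeta :: "params \<Rightarrow> real" where
  "zeta S = rho_f S * circ S * asym_mu S"

definition chi :: "params \<Rightarrow> real" where
  "chi S = rho_f S * circ S * asym_nu S"

(* dxi, deta are the velocities of the point mass relative to the body; "motion" below forces
   them to be the derivatives of xi, eta. *)
record control =
  xi :: "real \<Rightarrow> real"
  eta :: "real \<Rightarrow> real"
  dxi :: "real \<Rightarrow> real"
  deta :: "real \<Rightarrow> real"
  Omega :: "real \<Rightarrow> real"

record trajectory =
  pos_x :: "real \<Rightarrow> real"
  pos_y :: "real \<Rightarrow> real"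
  angle :: "real \<Rightarrow> real"
  v1 :: "real \<Rightarrow> real"
  v2 :: "real \<Rightarrow> real"
  omega :: "real \<Rightarrow> real"

definition a1 :: "params \<Rightarrow> real" where
  "a1 S = m_b S + m_p S + m_r S + lam1 S"

definition a2 :: "params \<Rightarrow> real" where
  "a2 S = m_b S + m_p S + m_r S + lam2 S"

definition coef_f :: "params \<Rightarrow> control \<Rightarrow> real \<Rightarrow> real" where
  "coef_f S u t = - m_p S * eta u t"

definition coef_g :: "params \<Rightarrow> control \<Rightarrow> real \<Rightarrow> real" where
  "coef_g S u t = m_p S * xi u t"

definition coef_b :: "params \<Rightarrow> control \<Rightarrow> real \<Rightarrow> real" where
  "coef_b S u t =
     m_b S * ((xi_b S)\<^sup>2 + (eta_b S)\<^sup>2) + I_b S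
     + m_p S * ((xi u t)\<^sup>2 + (eta u t)\<^sup>2)
     + m_r S * ((xi_r S)\<^sup>2 + (eta_r S)\<^sup>2) + I_r S + lam6 S"

definition p_x :: "params \<Rightarrow> control \<Rightarrow> trajectory \<Rightarrow> real \<Rightarrow> real" where
  "p_x S u q t =
     (a1 S * v1 q t + coef_f S u t * omega q t + m_p S * dxi u t - chi S) * cos (angle q t)
     - (a2 S * v2 q t + coef_g S u t * omega q t + m_p S * deta u t - zeta S) * sin (angle q t)
     + lam S * pos_y q t"

definition p_y :: "params \<Rightarrow> control \<Rightarrow> trajectory \<Rightarrow> real \<Rightarrow> real" where
  "p_y S u q t =
     (a1 S * v1 q t + coef_f S u t * omega q t + m_p S * dxi u t - chi S) * sin (angle q t)
     + (a2 S * v2 q t + coef_g S u t * omega q t + m_p S * deta u t - zeta S) * cos (angle q t)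
     - lam S * pos_x q t"

definition K_int :: "params \<Rightarrow> control \<Rightarrow> trajectory \<Rightarrow> real \<Rightarrow> real" where
  "K_int S u q t =
     coef_f S u t * v1 q t + coef_g S u t * v2 q t + coef_b S u t * omega q t
     + m_p S * (xi u t * deta u t - dxi u t * eta u t) + I_r S * Omega u t
     + lam S / 2 * ((pos_x q t)\<^sup>2 + (pos_y q t)\<^sup>2)
     + pos_x q t * p_y S u q t - pos_y q t * p_x S u q t"

(* u and q form a motion on the time interval J, on the level set (px, py, K) of the integrals.
   Fixing the level replaces the equations of motion: the three integrals determine v1, v2 and
   omega.  At an end point of J all derivatives are one-sided, so that controls may be switched
   with a jump in velocity. *)
definition motion ::
  "params \<Rightarrow> real set \<Rightarrow> real \<Rightarrow> real \<Rightarrow> real \<Rightarrow> control \<Rightarrow> trajectory \<Rightarrow> bool" where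
  "motion S J px py K u q \<longleftrightarrow> (\<forall>t\<in>J.
     (xi u has_real_derivative dxi u t) (at t within J) \<and>
     (eta u has_real_derivative deta u t) (at t within J) \<and>
     (pos_x q has_real_derivative v1 q t * cos (angle q t) - v2 q t * sin (angle q t))
       (at t within J) \<and>
     (pos_y q has_real_derivative v1 q t * sin (angle q t) + v2 q t * cos (angle q t))
       (at t within J) \<and>
     (angle q has_real_derivative omega q t) (at t within J) \<and>
     p_x S u q t = px \<and> p_y S u q t = py \<and> K_int S u q t = K)"

definition limited_control :: "params \<Rightarrow> real set \<Rightarrow> control \<Rightarrow> bool" where
  "limited_control S J u \<longleftrightarrow>
     (\<forall>t\<in>J. (xi u t, eta u t) \<in> region S) \<and>
     (\<exists>B. \<forall>t\<in>J. \<bar>dxi u t\<bar> \<le> B \<and> \<bar>deta u t\<bar> \<le> B \<and> \<bar>Omega u t\<bar> \<le> B)"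

(* At time T the origin of the body frame is at (x, y), the body has orientation \<alpha>, and the
   point mass is at the point s of the body; u is applied from then on.  The level is the one of
   the motions that start from rest at x = y = \<alpha> = 0. *)
definition stabilizing_control ::
  "params \<Rightarrow> real \<Rightarrow> real \<times> real \<Rightarrow> real \<Rightarrow> real \<Rightarrow> real \<Rightarrow> control \<Rightarrow> bool" where
  "stabilizing_control S T s x y \<alpha> u \<longleftrightarrow>
     limited_control S {T..} u \<and> (xi u T, eta u T) = s \<and>
     (\<exists>q. motion S {T..} (- chi S) (- zeta S) 0 u q \<and>
          (\<forall>t\<ge>T. pos_x q t = x \<and> pos_y q t = y \<and> angle q t = \<alpha>))"

definition complete_stabilization_possible ::
  "params \<Rightarrow> real \<Rightarrow> real \<times> real \<Rightarrow> real \<Rightarrow> real \<Rightarrow> real \<Rightarrow> bool" where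
  "complete_stabilization_possible S T s x y \<alpha> \<longleftrightarrow> (\<exists>u. stabilizing_control S T s x y \<alpha> u)"

end

theory Submission
  imports Defs
begin

text \<open>A body at rest has \<open>v\<^sub>1 = v\<^sub>2 = \<omega> = 0\<close>, so the level conditions for \<open>p\<^sub>x, p\<^sub>y\<close> express the
  relative velocity of the point mass through the fixed position and orientation. It is therefore
  constant, and since the mass stays in a bounded region it vanishes. What remains of the two
  conditions says that \<open>(\<lambda> x - \<zeta>, \<lambda> y + \<chi>)\<close> is the vector \<open>(\<chi>, \<zeta>)\<close> rotated by \<open>\<alpha> + \<pi>/2\<close>; comparing
  norms gives \<open>\<lambda>/2 (x\<^sup>2 + y\<^sup>2) - \<zeta> x + \<chi> y = 0\<close>, which turns \<open>K = 0\<close> into \<open>I\<^sub>r \<Omega> = 0\<close>.\<close>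

text \<open>The derivative at \<open>T\<close> is one-sided, so the comparison with a constant is
  made in the filter \<open>at_right t\<close>, which is nontrivial at every point of the ray
  including its end point; there derivatives are unique.\<close>

lemma derivative_zero_if_constant_on_ray:
  fixes F :: "real \<Rightarrow> real"
  assumes "(F has_real_derivative D) (at t within {T..})" "t \<ge> T" "\<And>s. s \<ge> T \<Longrightarrow> F s = c"
  shows "D = 0"
proof -
  have "((\<lambda>_. c) has_real_derivative D) (at t within {T..})"
    using assms by (intro has_field_derivative_transform_within[OF assms(1), of 1]) auto
  then have "((\<lambda>_. c) has_real_derivative D) (at_right t)"
    by (rule DERIV_subset) (use assms(2) in auto)
  then show ?thesis
    using has_field_derivative_unique[OF _ DERIV_const] trivial_limit_at_right_real by blast
qed

lemma derivative_zero_if_constant_derivative_and_bounded: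
  fixes F :: "real \<Rightarrow> real"
  assumes F: "\<And>t. t \<ge> T \<Longrightarrow> (F has_real_derivative D) (at t within {T..})"
    and B: "\<And>t. t \<ge> T \<Longrightarrow> \<bar>F t\<bar> \<le> B"
  shows "D = 0"
proof (rule ccontr)
  assume "D \<noteq> 0"
  have "\<exists>c. \<forall>t\<in>{T..}. F t - D * t = c"
  proof (rule has_field_derivative_zero_constant)
    fix t assume "t \<in> {T..}"
    then show "((\<lambda>t. F t - D * t) has_real_derivative 0) (at t within {T..})"
      by (auto intro!: derivative_eq_intros F)
  qed auto
  then obtain c where c: "\<And>t. t \<ge> T \<Longrightarrow> F t = c + D * t"
    by (auto simp: algebra_simps)
  \<comment> \<open>Values bounded by \<open>B\<close> differ by at most \<open>2 * B\<close>; over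
    a time \<open>h\<close> the affine function \<open>F\<close> changes by
    \<open>2 * B + 1\<close>.\<close>
  define h where "h = (2 * B + 1) / \<bar>D\<bar>"
  have "B \<ge> 0" using B[of T] by linarith
  then have "h \<ge> 0" by (simp add: h_def)
  have "\<bar>D * h\<bar> = 2 * B + 1"
    using \<open>D \<noteq> 0\<close> \<open>B \<ge> 0\<close> by (simp add: h_def abs_mult)
  moreover have "F (T + h) - F T = D * h"
    using c[of T] c[of "T + h"] \<open>h \<ge> 0\<close> by (simp add: algebra_simps)
  ultimately show False
    using B[of T] B[of "T + h"] \<open>h \<ge> 0\<close> by linarith
qed

lemma inverse_rotation:
  fixes P Q a :: real
  assumes "P * cos a - Q * sin a = X" "P * sin a + Q * cos a = Y"
  shows "P = X * cos a + Y * sin a" "Q = Y * cos a - X * sin a"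
proof -
  \<comment> \<open>With the Pythagorean factor kept, both equations are polynomial identities in
    \<open>sin a\<close> and \<open>cos a\<close>.\<close>
  have "X * cos a + Y * sin a = P * ((sin a)\<^sup>2 + (cos a)\<^sup>2)"
    "Y * cos a - X * sin a = Q * ((sin a)\<^sup>2 + (cos a)\<^sup>2)"
    unfolding assms[symmetric] by algebra+
  then show "P = X * cos a + Y * sin a" "Q = Y * cos a - X * sin a"
    by simp_all
qed

lemma angle_in_period_mod_2pi:
  fixes a :: real
  obtains \<theta> k where "0 \<le> \<theta>" "\<theta> < 2 * pi" "a = \<theta> + 2 * pi * of_int k"
proof
  define k where "k = \<lfloor>a / (2 * pi)\<rfloor>"
  have "of_int k \<le> a / (2 * pi)" "a / (2 * pi) < of_int k + 1"
    by (simp_all add: k_def)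
  then show "0 \<le> a - 2 * pi * of_int k" "a - 2 * pi * of_int k < 2 * pi"
    by (simp_all add: field_simps)
qed simp

text \<open>These are the level conditions for \<open>p_y\<close> and \<open>p_x\<close>, in this
  order, when body and point mass are at rest. In complex form: (lam x - zeta) + i (lam y + chi) = i
  exp(i \<alpha>) (chi + i zeta).\<close>

definition equilibrium :: "params \<Rightarrow> real \<Rightarrow> real \<Rightarrow> real \<Rightarrow> bool" where
  "equilibrium S x y \<alpha> \<longleftrightarrow>
     lam S * x - zeta S = - chi S * sin \<alpha> - zeta S * cos \<alpha> \<and>
     lam S * y + chi S = chi S * cos \<alpha> - zeta S * sin \<alpha>"

text \<open>The left-hand side is what \<open>K_int\<close> leaves besides the rotor term when
  nothing moves and \<open>p_x\<close>, \<open>p_y\<close> have their level values. It vanishes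
  because a rotation preserves the norm: after cancelling chi^2 + zeta^2 only a multiple of it
  remains.\<close>

lemma equilibrium_quadratic:
  assumes "equilibrium S x y \<alpha>" "lam S \<noteq> 0"
  shows "lam S / 2 * (x\<^sup>2 + y\<^sup>2) - x * zeta S + y * chi S = 0"
proof -
  have "(lam S * x - zeta S)\<^sup>2 + (lam S * y + chi S)\<^sup>2
      = ((chi S)\<^sup>2 + (zeta S)\<^sup>2) * ((sin \<alpha>)\<^sup>2 + (cos \<alpha>)\<^sup>2)"
    using assms(1) unfolding equilibrium_def by algebra
  then have "(lam S * x - zeta S)\<^sup>2 + (lam S * y + chi S)\<^sup>2 = (chi S)\<^sup>2 + (zeta S)\<^sup>2"
    by simp
  then have "2 * lam S * (lam S / 2 * (x\<^sup>2 + y\<^sup>2) - x * zeta S + y * chi S) = 0"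
    by (simp add: power2_eq_square algebra_simps)
  then show ?thesis using assms(2) by simp
qed

lemma stabilizing_control_imp:
  assumes S: "valid_params S" "lam S \<noteq> 0" and u: "stabilizing_control S T s x y \<alpha> u"
  shows "equilibrium S x y \<alpha>"
    and "\<And>t. t \<ge> T \<Longrightarrow> dxi u t = 0 \<and> deta u t = 0 \<and> Omega u t = 0"
proof -
  obtain q where q: "motion S {T..} (- chi S) (- zeta S) 0 u q"
    and rest: "\<And>t. t \<ge> T \<Longrightarrow> pos_x q t = x" "\<And>t. t \<ge> T \<Longrightarrow> pos_y q t = y"
      "\<And>t. t \<ge> T \<Longrightarrow> angle q t = \<alpha>"
    and region: "\<And>t. t \<ge> T \<Longrightarrow> (xi u t, eta u t) \<in> region S"
    using u unfolding stabilizing_control_def limited_control_def by auto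
  obtain B where B: "\<And>z. z \<in> region S \<Longrightarrow> norm z \<le> B"
    using S(1) unfolding valid_params_def bounded_iff by blast
  have bound: "\<bar>xi u t\<bar> \<le> B" "\<bar>eta u t\<bar> \<le> B" if "t \<ge> T" for t
    using B[OF region[OF that]] norm_fst_le[of "xi u t" "eta u t"] norm_snd_le[of "eta u t" "xi u t"]
    by auto
  have pos: "m_p S > 0" "I_r S > 0"
    using S(1) by (simp_all add: valid_params_def)
  have deriv: "(xi u has_real_derivative dxi u t) (at t within {T..})"
    "(eta u has_real_derivative deta u t) (at t within {T..})"
    "(pos_x q has_real_derivative v1 q t * cos (angle q t) - v2 q t * sin (angle q t))
       (at t within {T..})"
    "(pos_y q has_real_derivative v1 q t * sin (angle q t) + v2 q t * cos (angle q t))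
       (at t within {T..})"
    "(angle q has_real_derivative omega q t) (at t within {T..})"
    and level: "p_x S u q t = - chi S" "p_y S u q t = - zeta S" "K_int S u q t = 0"
    if "t \<ge> T" for t
    using q that unfolding motion_def by auto
  have still: "v1 q t = 0" "v2 q t = 0" "omega q t = 0" if t: "t \<ge> T" for t
  proof -
    show "omega q t = 0"
      using derivative_zero_if_constant_on_ray[OF deriv(5)[OF t] t] rest by blast
    have "v1 q t * cos (angle q t) - v2 q t * sin (angle q t) = 0"
      using derivative_zero_if_constant_on_ray[OF deriv(3)[OF t] t] rest by blast
    moreover have "v1 q t * sin (angle q t) + v2 q t * cos (angle q t) = 0"
      using derivative_zero_if_constant_on_ray[OF deriv(4)[OF t] t] rest by blast
    ultimately show "v1 q t = 0" "v2 q t = 0"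
      \<comment> \<open>A rotated vector is zero only if the vector is, so this is the case X = Y =
        0.\<close>
      using inverse_rotation by fastforce+
  qed
  have lin: "(m_p S * dxi u t - chi S) * cos \<alpha> - (m_p S * deta u t - zeta S) * sin \<alpha>
        = - chi S - lam S * y"
    "(m_p S * dxi u t - chi S) * sin \<alpha> + (m_p S * deta u t - zeta S) * cos \<alpha>
        = - zeta S + lam S * x"
    if "t \<ge> T" for t
    using level(1,2)[OF that] by (simp_all add: p_x_def p_y_def rest still that)
  define X Y where "X = - chi S - lam S * y" and "Y = - zeta S + lam S * x"
  \<comment> \<open>Rotating \<open>lin\<close> back by \<alpha> and solving for the relative
    velocity of the mass gives these values, in which \<open>t\<close> no longer occurs.\<close>
  define d e where "d = (chi S + X * cos \<alpha> + Y * sin \<alpha>) / m_p S"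
    and "e = (zeta S + Y * cos \<alpha> - X * sin \<alpha>) / m_p S"
  have const: "dxi u t = d" "deta u t = e" if "t \<ge> T" for t
    using inverse_rotation[OF lin[OF that]] pos
    by (simp_all add: d_def e_def X_def Y_def field_simps)
  have "d = 0"
    by (rule derivative_zero_if_constant_derivative_and_bounded[of T "xi u" _ B])
      (use deriv(1) const(1) bound in force)+
  moreover have "e = 0"
    by (rule derivative_zero_if_constant_derivative_and_bounded[of T "eta u" _ B])
      (use deriv(2) const(2) bound in force)+
  ultimately have zero: "dxi u t = 0" "deta u t = 0" if "t \<ge> T" for t
    using const that by auto
  show eq: "equilibrium S x y \<alpha>"
    using lin[of T] by (simp add: zero equilibrium_def)
  show "dxi u t = 0 \<and> deta u t = 0 \<and> Omega u t = 0" if t: "t \<ge> T" for t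
  proof -
    have "I_r S * Omega u t + (lam S / 2 * (x\<^sup>2 + y\<^sup>2) - x * zeta S + y * chi S) = 0"
      using level(3)[OF t] by (simp add: K_int_def level zero still rest t)
    then show ?thesis
      using equilibrium_quadratic[OF eq S(2)] pos zero t by simp
  qed
qed

lemma equilibrium_imp_stabilization:
  assumes eq: "equilibrium S x y \<alpha>" and "lam S \<noteq> 0" "s \<in> region S"
  shows "complete_stabilization_possible S T s x y \<alpha>"
proof -
  \<comment> \<open>The mass is parked where it is found at time \<open>T\<close>; its velocity may
    jump to zero there, since derivatives at \<open>T\<close> are one-sided.\<close>
  define u where "u = \<lparr>xi = \<lambda>_. fst s, eta = \<lambda>_. snd s, dxi = \<lambda>_. 0, deta = \<lambda>_. 0, Omega = \<lambda>_. 0\<rparr>"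
  define q where "q = \<lparr>pos_x = \<lambda>_. x, pos_y = \<lambda>_. y, angle = \<lambda>_. \<alpha>,
    v1 = \<lambda>_. 0, v2 = \<lambda>_. 0, omega = \<lambda>_. 0\<rparr>"
  have p: "p_x S u q t = - chi S" "p_y S u q t = - zeta S" for t
    using eq by (simp_all add: equilibrium_def p_x_def p_y_def u_def q_def)
  have "K_int S u q t = 0" for t
    using equilibrium_quadratic[OF eq assms(2)]
    \<comment> \<open>The momenta are replaced by their level values first; once \<open>u\<close>
      and \<open>q\<close> are unfolded, \<open>p\<close> would no longer match.\<close>
    by (simp add: K_int_def p) (simp add: u_def q_def)
  then have "motion S {T..} (- chi S) (- zeta S) 0 u q"
    unfolding motion_def by (simp add: p) (simp add: u_def q_def)
  moreover have "limited_control S {T..} u"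
    using assms(3) by (auto simp: limited_control_def u_def)
  ultimately show ?thesis
    unfolding complete_stabilization_possible_def stabilizing_control_def
    by (intro exI[of _ u] conjI exI[of _ q]) (simp_all add: u_def q_def)
qed

text \<open>With chi + i zeta = R exp(i \<beta>) the right-hand side of the complex form of
  \<open>equilibrium\<close> is R exp(i (\<alpha> + \<beta> + pi/2)), so \<theta> is \<alpha> +
  \<beta> + pi/2 modulo 2 pi. The sign of \<open>lam S\<close> is arbitrary: for negative
  \<open>lam S\<close> the point lies opposite to the direction \<theta> as seen from the centre of
  the circle.\<close>

lemma equilibrium_iff_circle:
  assumes "lam S \<noteq> 0" "(chi S, zeta S) \<noteq> (0, 0)"
    and "cos \<beta> = chi S / sqrt ((chi S)\<^sup>2 + (zeta S)\<^sup>2)"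
    and "sin \<beta> = zeta S / sqrt ((chi S)\<^sup>2 + (zeta S)\<^sup>2)"
  shows "equilibrium S x y \<alpha> \<longleftrightarrow>
    (\<exists>\<theta>. 0 \<le> \<theta> \<and> \<theta> < 2 * pi \<and>
       x = zeta S / lam S + sqrt ((chi S)\<^sup>2 + (zeta S)\<^sup>2) / lam S * cos \<theta> \<and>
       y = - chi S / lam S + sqrt ((chi S)\<^sup>2 + (zeta S)\<^sup>2) / lam S * sin \<theta> \<and>
       (\<exists>k::int. \<alpha> = \<theta> - \<beta> - pi / 2 + 2 * pi * of_int k))"
    (is "_ \<longleftrightarrow> (\<exists>\<theta>. _ \<and> _ \<and> ?X \<theta> \<and> ?Y \<theta> \<and> _)")
proof -
  define R where "R = sqrt ((chi S)\<^sup>2 + (zeta S)\<^sup>2)"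
  have "R \<noteq> 0" using assms(2) by (auto simp: R_def)
  then have \<beta>: "chi S = R * cos \<beta>" "zeta S = R * sin \<beta>"
    using assms(3,4) by (simp_all add: R_def)
  \<comment> \<open>Any representative \<theta> of the angle is allowed here, so this serves both
    directions; the range of \<theta> has to be arranged only when a witness is produced.\<close>
  have *: "equilibrium S x y \<alpha> \<longleftrightarrow> ?X \<theta> \<and> ?Y \<theta>"
    if "\<alpha> + \<beta> + pi / 2 = \<theta> + 2 * pi * of_int k" for \<theta> and k :: int
  proof -
    have "cos \<theta> = cos (\<theta> + 2 * pi * of_int k)" "sin \<theta> = sin (\<theta> + 2 * pi * of_int k)"
      by (simp_all add: cos_add sin_add)
    then have "cos \<theta> = - sin (\<alpha> + \<beta>)" "sin \<theta> = cos (\<alpha> + \<beta>)"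
      unfolding that[symmetric] by (simp_all add: cos_add sin_add)
    then have "R * cos \<theta> = - chi S * sin \<alpha> - zeta S * cos \<alpha>"
      "R * sin \<theta> = chi S * cos \<alpha> - zeta S * sin \<alpha>"
      by (simp_all only: \<beta> cos_add sin_add) (simp_all add: algebra_simps)
    then show ?thesis
      using assms(1) unfolding equilibrium_def R_def[symmetric] by (auto simp: field_simps)
  qed
  show ?thesis
  proof
    assume eq: "equilibrium S x y \<alpha>"
    obtain \<theta> k where \<theta>: "0 \<le> \<theta>" "\<theta> < 2 * pi"
      and k: "\<alpha> + \<beta> + pi / 2 = \<theta> + 2 * pi * of_int k"
      by (rule angle_in_period_mod_2pi)
    then have "\<alpha> = \<theta> - \<beta> - pi / 2 + 2 * pi * of_int k" by simp
    with \<theta> *[OF k] eq show "\<exists>\<theta>. 0 \<le> \<theta> \<and> \<theta> < 2 * pi \<and> ?X \<theta> \<and> ?Y \<theta> \<and>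
        (\<exists>k::int. \<alpha> = \<theta> - \<beta> - pi / 2 + 2 * pi * of_int k)" by blast
  next
    assume "\<exists>\<theta>. 0 \<le> \<theta> \<and> \<theta> < 2 * pi \<and> ?X \<theta> \<and> ?Y \<theta> \<and>
        (\<exists>k::int. \<alpha> = \<theta> - \<beta> - pi / 2 + 2 * pi * of_int k)"
    then obtain \<theta> and k :: int where "?X \<theta> \<and> ?Y \<theta>"
      and k: "\<alpha> = \<theta> - \<beta> - pi / 2 + 2 * pi * of_int k" by blast
    then show "equilibrium S x y \<alpha>" using *[of \<theta> k] by simp
  qed
qed

theorem proposition4p1:
  fixes S :: params and T x y \<alpha> \<beta> :: real and s :: "real \<times> real"
  assumes "valid_params S"
    and "lam S \<noteq> 0"
    and "(chi S, zeta S) \<noteq> (0, 0)"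
    and "T \<ge> 0"
    and "s \<in> region S"
    and "cos \<beta> = chi S / sqrt ((chi S)\<^sup>2 + (zeta S)\<^sup>2)"
    and "sin \<beta> = zeta S / sqrt ((chi S)\<^sup>2 + (zeta S)\<^sup>2)"
  shows "(complete_stabilization_possible S T s x y \<alpha> \<longleftrightarrow>
           (\<exists>\<theta>. 0 \<le> \<theta> \<and> \<theta> < 2 * pi \<and>
              x = zeta S / lam S + sqrt ((chi S)\<^sup>2 + (zeta S)\<^sup>2) / lam S * cos \<theta> \<and>
              y = - chi S / lam S + sqrt ((chi S)\<^sup>2 + (zeta S)\<^sup>2) / lam S * sin \<theta> \<and>
              (\<exists>k::int. \<alpha> = \<theta> - \<beta> - pi / 2 + 2 * pi * of_int k)))
       \<and> (\<forall>u. stabilizing_control S T s x y \<alpha> u \<longrightarrow>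
              (\<forall>t\<ge>T. dxi u t = 0 \<and> deta u t = 0 \<and> Omega u t = 0))"
  unfolding equilibrium_iff_circle[OF assms(2,3,6,7), symmetric]
  using stabilizing_control_imp[OF assms(1,2)] equilibrium_imp_stabilization[OF _ assms(2,5)]
  unfolding complete_stabilization_possible_def by blast

end
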